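(* Every Composed Grand Lebesgue Space $X=CGLS(T,\mu;a,b;\langle\cdot\rangle)$ has the ACN (absolutely continuous norm) property: for every $f\in X$ and every decreasing sequence of measurable sets $E_n\subset T$ with $\bigcap_nE_n=\emptyset$ $\mu$-almost everywhere, $$\lim_{n\to\infty}\|f\cdot I(E_n)\|_X=0 .$$
   Context: Let $(T,\mathcal A,\mu)$ be a measurable space with a non-trivial sigma-finite measure $\mu$. For measurable $f:T\to\mathbb R$ put $|f|_p=\left(\int_T|f|^p\,d\mu\right)^{1/p}$, $p\ge1$. $I(E)$ denotes the indicator function of a set $E$. Let $1\le a<b\le\infty$ and let $\langle\cdot\rangle$ be a rearrangement invariant (function) norm on real functions defined on the interval $(a,b)$, not necessarily finite on all functions. The Composed Grand Lebesgue Space $X=CGLS(T,\mu;a,b;\langle\cdot\rangle)$ is the space of (classes of) measurable functions $f:T\to\mathbb R$ with $\|f\|_X:=\langle h\rangle<\infty$, where $h(p)=|f|_p$, $p\in(a,b)$. Standing assumption: the norm $\langle\cdot\rangle$ is order continuous, i.e. for every sequence of functions $g_n$ on $(a,b)$ with $\langle g_n\rangle<\infty$, $g_n(\cdot)\downarrow0$ implies $\langle g_n\rangle\downarrow0$. *)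

theory Defs
  imports "HOL-Analysis.Analysis"
begin

text \<open>
  A norm on functions on \<open>(a,b)\<close> is given, as usual for function norms, by its values on the
  measurable functions with values in \<open>[0,\<infinity>]\<close>; the norm of a signed function \<open>g\<close> is the value
  at \<open>\<bar>g\<bar>\<close>. The value \<open>\<infinity>\<close> must be allowed for the arguments because \<open>p \<mapsto> |f|\<^sub>p\<close> may be infinite.
  The endpoint \<open>b\<close> may be \<open>\<infinity>\<close>, hence the extended interval.
\<close>

abbreviation ivl_measure :: "real \<Rightarrow> ereal \<Rightarrow> real measure" where
  "ivl_measure a b \<equiv> lebesgue_on (einterval (ereal a) b)"

text \<open>
  The AE-version of monotonicity makes the norm well defined on classes; in particular it ignores
  the values of its argument outside \<open>(a,b)\<close>. No Fatou property and no finiteness on any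
  particular functions is required.
\<close>

definition function_norm :: "real \<Rightarrow> ereal \<Rightarrow> ((real \<Rightarrow> ennreal) \<Rightarrow> ennreal) \<Rightarrow> bool" where
  "function_norm a b N \<longleftrightarrow>
     (\<forall>g \<in> borel_measurable (ivl_measure a b).
        N g = 0 \<longleftrightarrow> (AE p in ivl_measure a b. g p = 0)) \<and>
     (\<forall>g \<in> borel_measurable (ivl_measure a b). \<forall>c::real. c \<ge> 0 \<longrightarrow>
        N (\<lambda>p. ennreal c * g p) = ennreal c * N g) \<and>
     (\<forall>g \<in> borel_measurable (ivl_measure a b). \<forall>k \<in> borel_measurable (ivl_measure a b).
        N (\<lambda>p. g p + k p) \<le> N g + N k) \<and>
     (\<forall>g \<in> borel_measurable (ivl_measure a b). \<forall>k \<in> borel_measurable (ivl_measure a b).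
        (AE p in ivl_measure a b. g p \<le> k p) \<longrightarrow> N g \<le> N k)"

definition equimeasurable :: "'b measure \<Rightarrow> ('b \<Rightarrow> ennreal) \<Rightarrow> ('b \<Rightarrow> ennreal) \<Rightarrow> bool" where
  "equimeasurable L g k \<longleftrightarrow>
     (\<forall>t::ennreal. emeasure L {p \<in> space L. t < g p} = emeasure L {p \<in> space L. t < k p})"

text \<open>Invariance is asked for almost everywhere finite (that is, essentially real) functions only.\<close>

definition rearrangement_invariant ::
    "real \<Rightarrow> ereal \<Rightarrow> ((real \<Rightarrow> ennreal) \<Rightarrow> ennreal) \<Rightarrow> bool" where
  "rearrangement_invariant a b N \<longleftrightarrow>
     (\<forall>g \<in> borel_measurable (ivl_measure a b). \<forall>k \<in> borel_measurable (ivl_measure a b).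
        (AE p in ivl_measure a b. g p < \<infinity>) \<longrightarrow> (AE p in ivl_measure a b. k p < \<infinity>) \<longrightarrow>
        equimeasurable (ivl_measure a b) g k \<longrightarrow> N g = N k)"

definition order_continuous_norm ::
    "real \<Rightarrow> ereal \<Rightarrow> ((real \<Rightarrow> ennreal) \<Rightarrow> ennreal) \<Rightarrow> bool" where
  "order_continuous_norm a b N \<longleftrightarrow>
     (\<forall>g :: nat \<Rightarrow> real \<Rightarrow> ennreal.
        (\<forall>n. g n \<in> borel_measurable (ivl_measure a b)) \<longrightarrow>
        (\<forall>n. \<forall>p \<in> einterval (ereal a) b. g n p < \<infinity>) \<longrightarrow>
        (\<forall>n. N (g n) < \<infinity>) \<longrightarrow>
        (\<forall>p \<in> einterval (ereal a) b. decseq (\<lambda>n. g n p) \<and> (\<lambda>n. g n p) \<longlonglongrightarrow> 0) \<longrightarrow>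
        decseq (\<lambda>n. N (g n)) \<and> (\<lambda>n. N (g n)) \<longlonglongrightarrow> 0)"

definition Lp_norm :: "'a measure \<Rightarrow> real \<Rightarrow> ('a \<Rightarrow> real) \<Rightarrow> ennreal" where
  "Lp_norm M p f =
     (let I = \<integral>\<^sup>+ x. ennreal (\<bar>f x\<bar> powr p) \<partial>M
      in if I = \<infinity> then \<infinity> else ennreal (enn2real I powr (1 / p)))"

text \<open>The function \<open>p \<mapsto> |f|\<^sub>p\<close> on \<open>(a,b)\<close> is extended by the irrelevant value 0.\<close>

definition CGLS_norm ::
    "'a measure \<Rightarrow> real \<Rightarrow> ereal \<Rightarrow> ((real \<Rightarrow> ennreal) \<Rightarrow> ennreal) \<Rightarrow> ('a \<Rightarrow> real) \<Rightarrow> ennreal" where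
  "CGLS_norm M a b N f = N (\<lambda>p. if p \<in> einterval (ereal a) b then Lp_norm M p f else 0)"

definition CGLS ::
    "'a measure \<Rightarrow> real \<Rightarrow> ereal \<Rightarrow> ((real \<Rightarrow> ennreal) \<Rightarrow> ennreal) \<Rightarrow> ('a \<Rightarrow> real) set" where
  "CGLS M a b N = {f \<in> borel_measurable M. CGLS_norm M a b N f < \<infinity>}"

definition ACN_property ::
    "'a measure \<Rightarrow> ('a \<Rightarrow> real) set \<Rightarrow> (('a \<Rightarrow> real) \<Rightarrow> ennreal) \<Rightarrow> bool" where
  "ACN_property M X nrm \<longleftrightarrow>
     (\<forall>f \<in> X. \<forall>E :: nat \<Rightarrow> 'a set.
        (\<forall>n. E n \<in> sets M) \<longrightarrow> decseq E \<longrightarrow> (\<Inter>n. E n) \<in> null_sets M \<longrightarrow>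
        (\<lambda>n. nrm (\<lambda>x. f x * indicator (E n) x)) \<longlonglongrightarrow> 0)"

end

theory Submission
  imports Defs
begin

text \<open>
  Write \<open>h p = |f|\<^sub>p\<close> and \<open>h\<^sub>n p = |f \<cdot> I(E\<^sub>n)|\<^sub>p\<close>. Wherever \<open>h p\<close> is finite, \<open>|f|\<^sup>p\<close> is an integrable
  majorant of \<open>|f \<cdot> I(E\<^sub>n)|\<^sup>p\<close>, so \<open>h\<^sub>n p\<close> decreases to \<open>0\<close> by dominated convergence
  (\<open>Lp_norm_shrinking_tendsto_0\<close>). Order continuity of the norm on \<open>(a,b)\<close> therefore gives the claim
  as soon as \<open>h\<close> is finite, and this is where \<open>f \<in> X\<close> enters: the norm of a function cannot be finite
  unless the function is finite almost everywhere (\<open>function_norm_finite_imp_AE_finite\<close>).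

  Order continuity speaks about functions that are finite everywhere, while \<open>h\<close> is finite almost
  everywhere only. So it is applied to the \<open>h\<^sub>n\<close> set to \<open>0\<close> where \<open>h = \<infinity>\<close>; this does not change their
  norms. Everything rests on the measurability of \<open>p \<mapsto> |f|\<^sub>p\<close>, which is Tonelli's theorem for the
  sigma-finite measure and the jointly measurable function \<open>(p, x) \<mapsto> |f x|\<^sup>p\<close>
  (\<open>borel_measurable_Lp_norm\<close>).
\<close>

lemma borel_measurable_Lp_norm:
  assumes "sigma_finite_measure M" and [measurable]: "f \<in> borel_measurable M"
  shows "(\<lambda>p. Lp_norm M p f) \<in> borel_measurable borel"
proof -
  interpret sigma_finite_measure M by fact
  have [measurable]: "(\<lambda>p. \<integral>\<^sup>+ x. ennreal (\<bar>f x\<bar> powr p) \<partial>M) \<in> borel_measurable borel"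
    by (rule borel_measurable_nn_integral) measurable
  show ?thesis
    unfolding Lp_norm_def Let_def by measurable
qed

lemma borel_measurable_ivl_Lp_norm:
  assumes "sigma_finite_measure M" and "f \<in> borel_measurable M"
  shows "(\<lambda>p. if p \<in> einterval (ereal a) b then Lp_norm M p f else 0)
           \<in> borel_measurable (ivl_measure a b)"
proof -
  have "(\<lambda>p. Lp_norm M p f) \<in> borel_measurable lborel"
    using borel_measurable_Lp_norm[OF assms] by simp
  then have "(\<lambda>p. Lp_norm M p f) \<in> borel_measurable (ivl_measure a b)"
    by (intro measurable_restrict_space1 measurable_completion)
  then show ?thesis
    by (rule measurable_cong[THEN iffD1, rotated]) simp
qed

lemma Lp_norm_finite_iff:
  "Lp_norm M p f < \<infinity> \<longleftrightarrow> (\<integral>\<^sup>+ x. ennreal (\<bar>f x\<bar> powr p) \<partial>M) < \<infinity>"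
  by (auto simp: Lp_norm_def Let_def less_top)

lemma Lp_norm_mono:
  assumes "p > 0" and "\<And>x. x \<in> space M \<Longrightarrow> \<bar>f x\<bar> \<le> \<bar>g x\<bar>"
  shows "Lp_norm M p f \<le> Lp_norm M p g"
proof -
  have *: "(\<integral>\<^sup>+ x. ennreal (\<bar>f x\<bar> powr p) \<partial>M) \<le> (\<integral>\<^sup>+ x. ennreal (\<bar>g x\<bar> powr p) \<partial>M)"
    using assms by (intro nn_integral_mono ennreal_leI powr_mono2) auto
  show ?thesis
  proof (cases "(\<integral>\<^sup>+ x. ennreal (\<bar>g x\<bar> powr p) \<partial>M) = \<infinity>")
    case False
    then have fin: "(\<integral>\<^sup>+ x. ennreal (\<bar>f x\<bar> powr p) \<partial>M) \<noteq> \<infinity>"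
      using * by (auto simp: top_unique)
    show ?thesis
      unfolding Lp_norm_def Let_def using False fin * assms(1)
      by (auto intro!: ennreal_leI powr_mono2 enn2real_mono simp: less_top)
  qed (simp add: Lp_norm_def)
qed

lemma Lp_norm_shrinking_tendsto_0:
  fixes E :: "nat \<Rightarrow> 'a set"
  assumes p: "p > 0" and f [measurable]: "f \<in> borel_measurable M"
    and E [measurable]: "\<And>n. E n \<in> sets M" and dec: "decseq E"
    and null: "(\<Inter>n. E n) \<in> null_sets M"
    and fin: "Lp_norm M p f < \<infinity>"
  shows "(\<lambda>n. Lp_norm M p (\<lambda>x. f x * indicator (E n) x)) \<longlonglongrightarrow> 0"
proof -
  define u where "u n x = ennreal (\<bar>f x * indicator (E n) x\<bar> powr p)" for n x
  have [measurable]: "u n \<in> borel_measurable M" for n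
    unfolding u_def by measurable
  have u_le: "u n x \<le> ennreal (\<bar>f x\<bar> powr p)" for n x
    using p by (auto simp: u_def indicator_def)
  have u_fin: "(\<integral>\<^sup>+ x. u n x \<partial>M) < \<infinity>" for n
    using fin unfolding Lp_norm_finite_iff
    by (rule le_less_trans[rotated]) (auto intro!: nn_integral_mono u_le)
  have "(\<lambda>n. \<integral>\<^sup>+ x. u n x \<partial>M) \<longlonglongrightarrow> (\<integral>\<^sup>+ x. 0 \<partial>M)"
  proof (rule nn_integral_dominated_convergence[where w = "\<lambda>x. ennreal (\<bar>f x\<bar> powr p)"])
    show "AE x in M. (\<lambda>n. u n x) \<longlonglongrightarrow> 0"
      using AE_not_in[OF null]
    proof eventually_elim
      fix x assume "x \<notin> (\<Inter>n. E n)"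
      then obtain m where "x \<notin> E m" by auto
      then have "x \<notin> E n" if "n \<ge> m" for n
        using that dec by (auto dest: decseqD)
      then have "eventually (\<lambda>n. u n x = 0) sequentially"
        by (auto simp: eventually_sequentially u_def intro!: exI[of _ m])
      then show "(\<lambda>n. u n x) \<longlonglongrightarrow> 0"
        by (rule tendsto_eventually)
    qed
  qed (use u_le fin[unfolded Lp_norm_finite_iff] in auto)
  then have "(\<lambda>n. enn2real (\<integral>\<^sup>+ x. u n x \<partial>M)) \<longlonglongrightarrow> enn2real 0"
    by (intro tendsto_enn2real) (auto simp: u_fin less_top)
  then have "(\<lambda>n. enn2real (\<integral>\<^sup>+ x. u n x \<partial>M) powr (1 / p)) \<longlonglongrightarrow> 0 powr (1 / p)"
    using p by (intro tendsto_powr') (auto intro!: always_eventually)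
  then have "(\<lambda>n. ennreal (enn2real (\<integral>\<^sup>+ x. u n x \<partial>M) powr (1 / p))) \<longlonglongrightarrow> ennreal 0"
    by (intro tendsto_ennrealI) simp
  moreover have "Lp_norm M p (\<lambda>x. f x * indicator (E n) x)
      = ennreal (enn2real (\<integral>\<^sup>+ x. u n x \<partial>M) powr (1 / p))" for n
    using u_fin[of n] by (auto simp: Lp_norm_def u_def Let_def)
  ultimately show ?thesis by simp
qed

lemma function_norm_mono_AE:
  assumes "function_norm a b N"
    and "g \<in> borel_measurable (ivl_measure a b)" and "k \<in> borel_measurable (ivl_measure a b)"
    and "AE p in ivl_measure a b. g p \<le> k p"
  shows "N g \<le> N k"
  using assms unfolding function_norm_def by blast

lemma function_norm_cong_AE:
  assumes "function_norm a b N"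
    and "g \<in> borel_measurable (ivl_measure a b)" and "k \<in> borel_measurable (ivl_measure a b)"
    and "AE p in ivl_measure a b. g p = k p"
  shows "N g = N k"
  using assms by (intro antisym function_norm_mono_AE[of a b N]) (auto elim: eventually_mono)

text \<open>
  The function \<open>z\<close> that is \<open>\<infinity>\<close> where \<open>g\<close> is, and \<open>0\<close> elsewhere, satisfies \<open>2 z = z\<close>. So its norm is
  \<open>0\<close> or \<open>\<infinity>\<close>, and \<open>z \<le> g\<close> with \<open>g\<close> of finite norm excludes the latter. Definiteness then says that \<open>z\<close> vanishes almost
  everywhere.
\<close>

lemma function_norm_finite_imp_AE_finite:
  assumes N: "function_norm a b N"
    and g [measurable]: "g \<in> borel_measurable (ivl_measure a b)"
    and fin: "N g < \<infinity>"
  shows "AE p in ivl_measure a b. g p < \<infinity>"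
proof -
  define z where "z p = (if g p < \<infinity> then 0 else \<infinity> :: ennreal)" for p
  have z [measurable]: "z \<in> borel_measurable (ivl_measure a b)"
    unfolding z_def by measurable
  have "z p \<le> g p" for p
    by (auto simp: z_def less_top)
  then have "N z \<le> N g"
    by (intro function_norm_mono_AE[OF N z g]) simp
  with fin have z_fin: "N z \<noteq> \<infinity>"
    by (auto simp: top_unique)
  have "(\<lambda>p. ennreal 2 * z p) = z"
    by (auto simp: z_def fun_eq_iff ennreal_mult_top)
  moreover have "N (\<lambda>p. ennreal 2 * z p) = ennreal 2 * N z"
    using N z unfolding function_norm_def by (metis zero_le_numeral)
  ultimately have "N z = N z + N z"
    by (simp add: mult_2)
  with z_fin have "N z = 0"
    by (cases "N z") (auto simp flip: ennreal_plus)
  with N z have "AE p in ivl_measure a b. z p = 0"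
    unfolding function_norm_def by blast
  then show ?thesis
    by eventually_elim (auto simp: z_def split: if_splits)
qed

theorem theorem2p1:
  fixes M :: "'a measure"
    and a :: real and b :: ereal
    and N :: "(real \<Rightarrow> ennreal) \<Rightarrow> ennreal"
  assumes "sigma_finite_measure M"
    and "emeasure M (space M) \<noteq> 0"
    and "1 \<le> a" and "ereal a < b"
    and "function_norm a b N"
    and "rearrangement_invariant a b N"
    and "order_continuous_norm a b N"
  shows "ACN_property M (CGLS M a b N) (CGLS_norm M a b N)"
  unfolding ACN_property_def
proof (intro ballI allI impI)
  fix f and E :: "nat \<Rightarrow> 'a set"
  assume fX: "f \<in> CGLS M a b N" and E: "\<forall>n. E n \<in> sets M"
    and dec: "decseq E" and null: "(\<Inter>n. E n) \<in> null_sets M"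
  let ?S = "einterval (ereal a) b"
  have f [measurable]: "f \<in> borel_measurable M"
    using fX by (simp add: CGLS_def)
  have [measurable]: "E n \<in> sets M" for n
    using E by blast
  have pos: "p > 0" if "p \<in> ?S" for p
    using that \<open>1 \<le> a\<close> by (auto simp: einterval_def)
  define h where "h p = (if p \<in> ?S then Lp_norm M p f else 0)" for p
  define hE where
    "hE n p = (if p \<in> ?S then Lp_norm M p (\<lambda>x. f x * indicator (E n) x) else 0)" for n p
  have [measurable]: "h \<in> borel_measurable (ivl_measure a b)"
    unfolding h_def[abs_def] by (rule borel_measurable_ivl_Lp_norm) fact+
  have hE [measurable]: "hE n \<in> borel_measurable (ivl_measure a b)" for n
    unfolding hE_def[abs_def] by (rule borel_measurable_ivl_Lp_norm[OF assms(1)]) measurable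
  have Nh: "N h < \<infinity>"
    using fX by (simp add: CGLS_def CGLS_norm_def h_def[abs_def])
  have h_fin: "AE p in ivl_measure a b. h p < \<infinity>"
    by (rule function_norm_finite_imp_AE_finite[OF assms(5) _ Nh]) measurable
  have hE_le: "hE n p \<le> h p" for n p
    using pos by (auto simp: hE_def h_def indicator_def intro!: Lp_norm_mono)

  define g where "g n p = (if h p < \<infinity> then hE n p else 0)" for n p
  have g [measurable]: "g n \<in> borel_measurable (ivl_measure a b)" for n
    unfolding g_def[abs_def] by measurable
  have Ng: "N (g n) = N (hE n)" for n
    by (rule function_norm_cong_AE[OF assms(5) g hE])
      (use h_fin in eventually_elim, simp add: g_def)
  have "(\<lambda>n. N (g n)) \<longlonglongrightarrow> 0"
  proof -
    have "N (g n) < \<infinity>" for n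
      unfolding Ng
      by (rule le_less_trans[OF function_norm_mono_AE[OF assms(5)] Nh]) (auto simp: hE_le)
    moreover have "g n p < \<infinity>" for n p
      using le_less_trans[OF hE_le] by (auto simp: g_def)
    moreover have "decseq (\<lambda>n. g n p)" for p
    proof -
      have "hE n p \<le> hE m p" if "m \<le> n" for m n
        using pos decseqD[OF dec that]
        by (auto simp: hE_def indicator_def intro!: Lp_norm_mono)
      then show ?thesis by (auto simp: decseq_def g_def)
    qed
    moreover have "(\<lambda>n. g n p) \<longlonglongrightarrow> 0" if "p \<in> ?S" for p
      using that Lp_norm_shrinking_tendsto_0[OF pos f _ dec null] E
      by (cases "h p < \<infinity>") (auto simp: g_def hE_def h_def)
    ultimately show ?thesis
      using assms(7) g unfolding order_continuous_norm_def by blast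
  qed
  then show "(\<lambda>n. CGLS_norm M a b N (\<lambda>x. f x * indicator (E n) x)) \<longlonglongrightarrow> 0"
    by (simp add: Ng CGLS_norm_def hE_def[abs_def])
qed

end
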